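(* Let $\mathcal{W}$ be an additive complement of the squares. Then, for all sufficiently large $N$, $$\sum_{n\le N} f(n)-N\gg \frac{N^{3/4}}{\sqrt{T(N)}},$$ where the implied constant depends only on $\mathcal{W}$.
   Context: $\mathbb{N}=\{1,2,3,\dots\}$ and $\mathcal{S}=\{1^2,2^2,3^2,\dots\}$ is the set of squares. A set $\mathcal{W}\subset\mathbb{N}$ is an additive complement of the squares if all sufficiently large integers can be written as the sum of an element of $\mathcal{W}$ and an element of $\mathcal{S}$. For such $\mathcal{W}$, $f(n)=\#\{(w,m^2)\in\mathcal{W}\times\mathcal{S}: n=w+m^2\}$. For an integer $h\ge1$, $\tau(h)$ is the number of positive divisors of $h$, and $T(N)=\max_{1\le h\le N}\tau(h)$. Sums over $n\le N$ run over integers $1\le n\le N$. The notation $F(N)\gg G(N)$ means $F(N)\ge C\,G(N)$ for some constant $C>0$ (the implied constant). *)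

theory Defs
  imports Complex_Main
begin

text \<open>
  Natural numbers start at 1 here: the squares do not contain 0, and complements are
  required to consist of positive integers.
\<close>

definition squares :: "nat set" where
  "squares = {m ^ 2 | m. m \<ge> 1}"

definition additive_complement_of_squares :: "nat set \<Rightarrow> bool" where
  "additive_complement_of_squares W \<longleftrightarrow>
     W \<subseteq> {1..} \<and> (\<exists>n0. \<forall>n\<ge>n0. \<exists>w\<in>W. \<exists>s\<in>squares. n = w + s)"

definition rep_count :: "nat set \<Rightarrow> nat \<Rightarrow> nat" where
  "rep_count W n = card {(w, s). w \<in> W \<and> s \<in> squares \<and> n = w + s}"

text \<open>Only meaningful for positive arguments: 0 has infinitely many divisors, so the value there is 0.\<close>

definition num_divisors :: "nat \<Rightarrow> nat" where
  "num_divisors h = card {d. d dvd h}"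

text \<open>Only meaningful for \<open>N \<ge> 1\<close>, since the maximum of the empty set is unspecified.\<close>

definition max_num_divisors :: "nat \<Rightarrow> nat" where
  "max_num_divisors N = Max (num_divisors ` {1..N})"

end

theory Submission
  imports Defs "HOL-Analysis.Convex"
begin

text \<open>
  Let \<open>E\<close> be the sum of \<open>f n - 1\<close> over those \<open>n \<le> N\<close> with \<open>f n \<ge> 2\<close>; up to a bounded error it is the
  quantity to be bounded from below. Since the complement has at least about \<open>\<surd>N\<close> elements up to
  \<open>N\<close>, for each \<open>q\<close> of size a small multiple of \<open>\<surd>N\<close> many of them lie in a common class modulo
  \<open>4 q\<close>, and \<open>w' - w = 4 q j\<close> yields the coincidence \<open>w + (q + j)\<^sup>2 = w' + (q - j)\<^sup>2\<close>. Hence the sum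
  \<open>Z\<close> of \<open>(f n)\<^sup>2\<close> over \<open>f n \<ge> 2\<close> is at least of order \<open>N\<close>.

  In the other direction, two numbers \<open>n \<noteq> n'\<close> share at most \<open>\<tau>(\<bar>n - n'\<bar>) \<le> T\<close> elements \<open>w\<close>, so
  Cauchy-Schwarz over the \<open>O(\<surd>N)\<close> elements \<open>w\<close> gives \<open>Z\<^sup>2 \<le> O(\<surd>N) (F Z + T (2 E)\<^sup>2)\<close>, where \<open>F\<close>
  is the maximum of \<open>f\<close>. If the second term dominates, this is the claim. Otherwise \<open>F\<close> is of order
  \<open>\<surd>N\<close>. But a single \<open>n\<close> with \<open>f n = F\<close> already forces \<open>E\<close> to be of order \<open>F\<^sup>2\<close>: if \<open>n - m\<^sup>2\<close> and
  \<open>n - m'\<^sup>2\<close> are in the complement with \<open>m\<close> and \<open>m'\<close> congruent modulo \<open>4\<close>, then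
  \<open>n - m\<^sup>2 + ((5 m + 3 m') / 4)\<^sup>2\<close> is symmetric in \<open>m\<close> and \<open>m'\<close> and so has two representations.
\<close>

section \<open>Representations and the excess\<close>

text \<open>Given \<open>n\<close>, the summand \<open>w\<close> determines the square, so
  \<open>w\<close> alone is kept; this lets the sets of different \<open>n\<close> be
  intersected.\<close>

definition reps :: "nat set \<Rightarrow> nat \<Rightarrow> nat set" where
  "reps W n = {w \<in> W. \<exists>m\<ge>1. w + m ^ 2 = n}"

text \<open>Truncated subtraction lets an \<open>n\<close> without representation contribute 0
  instead of -1, so the excess is monotone in \<open>N\<close>.\<close>

definition excess :: "nat set \<Rightarrow> nat \<Rightarrow> nat" where
  "excess W N = (\<Sum>n = 1..N. card (reps W n) - 1)"

lemma finite_reps [simp]: "finite (reps W n)"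
  by (rule finite_subset[of _ "{..n}"]) (auto simp: reps_def)

lemma rep_count_eq: "rep_count W n = card (reps W n)"
proof -
  have "bij_betw fst {(w, s). w \<in> W \<and> s \<in> squares \<and> n = w + s} (reps W n)"
    by (rule bij_betwI[where g = "\<lambda>w. (w, n - w)"]) (auto simp: reps_def squares_def)
  then show ?thesis
    unfolding rep_count_def by (rule bij_betw_same_card)
qed

lemma excess_mono: "M \<le> N \<Longrightarrow> excess W M \<le> excess W N"
  unfolding excess_def by (rule sum_mono2) auto

text \<open>Truncation changes a summand only at unrepresented \<open>n\<close>, by 1, and these lie
  below \<open>n0\<close>.\<close>

lemma excess_le:
  assumes "\<And>n. n \<ge> n0 \<Longrightarrow> reps W n \<noteq> {}"
  shows "real (excess W N) \<le> real (\<Sum>n = 1..N. rep_count W n) - real N + real n0"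
proof -
  have "real (card (reps W n) - 1) \<le> real (card (reps W n)) - 1 + (if n < n0 then 1 else 0)" for n
  proof (cases "n < n0")
    case False
    then have "card (reps W n) \<ge> 1"
      using assms[of n] by (simp add: Suc_le_eq card_gt_0_iff)
    then show ?thesis using False by simp
  qed auto
  then have "real (excess W N) \<le>
      (\<Sum>n = 1..N. real (card (reps W n)) - 1 + (if n < n0 then 1 else 0))"
    unfolding excess_def of_nat_sum by (rule sum_mono)
  also have "\<dots> = real (\<Sum>n = 1..N. rep_count W n) - real N
      + real (card {n \<in> {1..N}. n < n0})"
    by (simp add: sum.distrib sum_subtractf rep_count_eq sum.If_cases Int_def)
  also have "card {n \<in> {1..N}. n < n0} \<le> card {..<n0}"
    by (rule card_mono) auto
  finally show ?thesis by simp
qed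

lemma sum_card_reps_le_excess:
  assumes "S \<subseteq> {1..N}" "\<And>n. n \<in> S \<Longrightarrow> card (reps W n) \<ge> 2"
  shows "(\<Sum>n\<in>S. card (reps W n)) \<le> 2 * excess W N"
proof -
  have "(\<Sum>n\<in>S. card (reps W n)) \<le> (\<Sum>n\<in>S. 2 * (card (reps W n) - 1))"
    using assms(2) by (intro sum_mono) force
  also have "\<dots> \<le> (\<Sum>n = 1..N. 2 * (card (reps W n) - 1))"
    using assms(1) by (intro sum_mono2) auto
  finally show ?thesis
    by (simp add: excess_def sum_distrib_left)
qed

section \<open>Common elements of two representation sets, and divisors\<close>

text \<open>If \<open>n - w = x\<^sup>2\<close> and \<open>n' - w = y\<^sup>2\<close>, then \<open>y - x\<close> divides \<open>n' - n\<close> and determines \<open>w\<close>.\<close>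

lemma card_common_reps_le:
  assumes "n < n'"
  shows "card (reps W n \<inter> reps W n') \<le> num_divisors (n' - n)"
proof -
  define g where "g w = (SOME d. \<exists>x y. w + x ^ 2 = n \<and> w + y ^ 2 = n' \<and> d + x = y)" for w
  have g: "\<exists>x y. w + x ^ 2 = n \<and> w + y ^ 2 = n' \<and> g w + x = y"
    if w: "w \<in> reps W n \<inter> reps W n'" for w
  proof -
    obtain x y where xy: "w + x ^ 2 = n" "w + y ^ 2 = n'"
      using w by (auto simp: reps_def)
    then have "x ^ 2 \<le> y ^ 2"
      using assms by linarith
    then have "x \<le> y"
      by (rule power2_le_imp_le) simp
    then have "\<exists>d. \<exists>x y. w + x ^ 2 = n \<and> w + y ^ 2 = n' \<and> d + x = y"
      using xy by (metis le_add_diff_inverse2)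
    then show ?thesis
      unfolding g_def by (rule someI_ex)
  qed
  have diff: "n' - n = d * (d + 2 * x)" if "w + x ^ 2 = n" "w + (d + x) ^ 2 = n'" for w d x
    using that by (auto simp: power2_eq_square algebra_simps)
  have "inj_on g (reps W n \<inter> reps W n')"
  proof (rule inj_onI)
    fix v w
    assume v: "v \<in> reps W n \<inter> reps W n'" and w: "w \<in> reps W n \<inter> reps W n'" and eq: "g v = g w"
    obtain x where x: "v + x ^ 2 = n" "v + (g v + x) ^ 2 = n'"
      using g[OF v] by blast
    obtain z where z: "w + z ^ 2 = n" "w + (g w + z) ^ 2 = n'"
      using g[OF w] by blast
    have "g v * (g v + 2 * x) = g v * (g v + 2 * z)"
      using diff[OF x] diff[OF z] eq by metis
    moreover have "g v \<noteq> 0"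
      using diff[OF x] assms by (metis mult_0 not_less zero_less_diff less_irrefl)
    ultimately have "x = z"
      by simp
    then show "v = w"
      using x(1) z(1) by simp
  qed
  moreover have "g ` (reps W n \<inter> reps W n') \<subseteq> {d. d dvd n' - n}"
    using g diff by (metis (mono_tags, lifting) dvd_triv_left image_subsetI mem_Collect_eq)
  moreover have "finite {d. d dvd n' - n}"
    using assms by simp
  ultimately show ?thesis
    unfolding num_divisors_def by (rule card_inj_on_le)
qed

lemma num_divisors_le_max: "1 \<le> h \<Longrightarrow> h \<le> N \<Longrightarrow> num_divisors h \<le> max_num_divisors N"
  unfolding max_num_divisors_def by (rule Max_ge) auto

lemma max_num_divisors_mono:
  assumes "1 \<le> M" "M \<le> N"
  shows "max_num_divisors M \<le> max_num_divisors N"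
  unfolding max_num_divisors_def using assms by (intro Max_mono image_mono) auto

lemma max_num_divisors_ge_1:
  assumes "1 \<le> N"
  shows "1 \<le> max_num_divisors N"
proof -
  have "num_divisors 1 = 1"
    by (simp add: num_divisors_def)
  then show ?thesis
    using num_divisors_le_max[of 1 N] assms by simp
qed

text \<open>This crude bound keeps N^(3/4) / sqrt T at least N^(1/4), enough to absorb the constant
  \<open>n0\<close> in the end.\<close>

lemma max_num_divisors_le:
  assumes "1 \<le> N"
  shows "max_num_divisors N \<le> N"
proof -
  have "num_divisors h \<le> N" if "h \<in> {1..N}" for h
  proof -
    have "{d. d dvd h} \<subseteq> {1..h}"
      using that by (auto dest: dvd_imp_le intro: Suc_leI dvd_pos_nat)
    then have "num_divisors h \<le> card {1..h}"
      unfolding num_divisors_def by (intro card_mono) auto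
    with that show ?thesis by simp
  qed
  then show ?thesis
    unfolding max_num_divisors_def using assms by (subst Max_le_iff) auto
qed

section \<open>Cauchy-Schwarz for overlapping sets\<close>

text \<open>Weight each \<open>R n\<close> by its size and sum over the elements of
  \<open>U\<close>. Cauchy-Schwarz and expansion of the square leave a sum over pairs
  \<open>(n, n')\<close> involving \<open>card (R n \<inter> R n')\<close>; \<open>F\<close>
  controls the diagonal, \<open>T\<close> the rest.\<close>

lemma sum_card_squared_le:
  fixes R :: "'a \<Rightarrow> 'b set" and F T :: real
  assumes "finite S" "finite U" and R: "\<And>n. n \<in> S \<Longrightarrow> R n \<subseteq> U"
    and F: "\<And>n. n \<in> S \<Longrightarrow> real (card (R n)) \<le> F"
    and T: "\<And>n n'. n \<in> S \<Longrightarrow> n' \<in> S \<Longrightarrow> n \<noteq> n' \<Longrightarrow> real (card (R n \<inter> R n')) \<le> T"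
    and "T \<ge> 0"
  shows "(\<Sum>n\<in>S. real (card (R n)) ^ 2) ^ 2 \<le>
           card U * (F * (\<Sum>n\<in>S. real (card (R n)) ^ 2) + T * (\<Sum>n\<in>S. real (card (R n))) ^ 2)"
proof -
  define f where "f n = real (card (R n))" for n
  define e :: "'b \<Rightarrow> 'a \<Rightarrow> real" where "e w n = of_bool (w \<in> R n)" for w n
  define g where "g w = (\<Sum>n\<in>S. f n * e w n)" for w
  have e1: "(\<Sum>w\<in>U. e w n) = f n" if "n \<in> S" for n
    using R[OF that] \<open>finite U\<close> by (simp add: e_def f_def sum.If_cases of_bool_def Int_absorb1)
  have e2: "(\<Sum>w\<in>U. e w n * e w n') = card (R n \<inter> R n')" if "n \<in> S" "n' \<in> S" for n n'
  proof -
    have "(\<Sum>w\<in>U. e w n * e w n') = (\<Sum>w\<in>U. if w \<in> R n \<inter> R n' then 1 else 0)"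
      by (intro sum.cong) (auto simp: e_def)
    also have "\<dots> = card (U \<inter> (R n \<inter> R n'))"
      using \<open>finite U\<close> by (simp add: sum.If_cases Collect_conj_eq)
    also have "U \<inter> (R n \<inter> R n') = R n \<inter> R n'"
      using R[OF that(1)] by auto
    finally show ?thesis .
  qed
  have "(\<Sum>n\<in>S. f n ^ 2) = (\<Sum>n\<in>S. \<Sum>w\<in>U. f n * e w n)"
    by (intro sum.cong refl) (simp add: e1 power2_eq_square flip: sum_distrib_left)
  also have "\<dots> = (\<Sum>w\<in>U. g w)"
    unfolding g_def by (rule sum.swap)
  finally have "(\<Sum>n\<in>S. f n ^ 2) ^ 2 = (\<Sum>w\<in>U. g w) ^ 2" by simp
  also have "\<dots> \<le> card U * (\<Sum>w\<in>U. g w ^ 2)"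
    using sum_squared_le_sum_of_squares[of g U] \<open>finite U\<close> by (simp add: mult.commute)
  also have "(\<Sum>w\<in>U. g w ^ 2) = (\<Sum>w\<in>U. \<Sum>n\<in>S. \<Sum>n'\<in>S. f n * f n' * (e w n * e w n'))"
    unfolding g_def power2_eq_square sum_product by (simp add: mult_ac)
  also have "\<dots> = (\<Sum>n\<in>S. \<Sum>n'\<in>S. f n * f n' * (\<Sum>w\<in>U. e w n * e w n'))"
    unfolding sum_distrib_left by (subst sum.swap, intro sum.cong refl, subst sum.swap) simp
  also have "\<dots> = (\<Sum>n\<in>S. \<Sum>n'\<in>S. f n * f n' * card (R n \<inter> R n'))"
    by (intro sum.cong refl) (simp add: e2)
  \<comment> \<open>The \<open>T\<close> term is added on the diagonal too, so that the double sum
    completes to a square.\<close>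
  also have "\<dots> \<le> (\<Sum>n\<in>S. \<Sum>n'\<in>S. (if n = n' then F * f n ^ 2 else 0) + T * (f n * f n'))"
  proof (intro sum_mono)
    fix n n' assume n: "n \<in> S" "n' \<in> S"
    have nonneg: "f n \<ge> 0" "f n' \<ge> 0" by (simp_all add: f_def)
    show "f n * f n' * card (R n \<inter> R n') \<le>
        (if n = n' then F * f n ^ 2 else 0) + T * (f n * f n')"
    proof (cases "n = n'")
      case True
      have "f n * f n * f n \<le> f n * f n * F"
        using F[OF n(1)] by (intro mult_left_mono) (auto simp: f_def)
      moreover have "0 \<le> T * (f n * f n)"
        using \<open>T \<ge> 0\<close> by simp
      ultimately show ?thesis
        using True by (simp add: power2_eq_square mult_ac flip: f_def)
    next
      case False
      then show ?thesis
        using mult_left_mono[OF T[OF n], of "f n * f n'"] nonneg by (simp add: mult.commute)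
    qed
  qed
  also have "\<dots> = F * (\<Sum>n\<in>S. f n ^ 2) + T * (\<Sum>n\<in>S. f n) ^ 2"
    using \<open>finite S\<close>
    by (simp add: sum.distrib power2_eq_square sum_product sum_distrib_left [of T]
        sum_distrib_left [of F])
  finally show ?thesis
    unfolding f_def by (simp add: mult_left_mono)
qed

section \<open>A number with many representations\<close>

text \<open>Each ordered pair of distinct roots in \<open>A\<close> yields a number with two
  representations. It is at most \<open>5 * n\<close>, because (5 m + 3 m') / 4 is at most twice the
  larger root.\<close>

lemma residue_class_le_excess:
  assumes "5 * n \<le> N" "finite A"
    and A: "\<And>m. m \<in> A \<Longrightarrow> m \<ge> 1 \<and> m mod 4 = r \<and> (\<exists>w\<in>W. w + m ^ 2 = n)"
  shows "card A * (card A - 1) \<le> 2 * excess W N"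
proof -
  \<comment> \<open>As 5^2 - 4^2 = 3^2, the difference 16 l^2 - 16 m^2 is 9 m^2 + 30 m m' + 9 m'^2,
    which is symmetric.\<close>
  define l where "l m m' = (5 * m + 3 * m') div 4" for m m' :: nat
  define v where "v m m' = n - m ^ 2 + l m m' ^ 2" for m m'
  define P where "P = Sigma A (\<lambda>m. A - {m})"
  define S where "S = (\<lambda>(m, m'). v m m') ` P"
  have le: "m ^ 2 \<le> n" if "m \<in> A" for m
    using A[OF that] by auto
  have in_W: "n - m ^ 2 \<in> W" if "m \<in> A" for m
    using A[OF that] by auto
  have l: "4 * l m m' = 5 * m + 3 * m'" if "m \<in> A" "m' \<in> A" for m m'
  proof -
    have "m mod 4 = m' mod 4"
      using A that by metis
    then have "(5 * m + 3 * m') mod 4 = (5 * m' + 3 * m') mod 4"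
      by (metis mod_add_cong mod_mult_cong)
    also have "\<dots> = 4 * (2 * m') mod 4"
      by simp
    finally have "4 dvd 5 * m + 3 * m'"
      by (simp add: mod_eq_0_iff_dvd del: mult_Suc)
    then show ?thesis
      by (simp add: l_def)
  qed
  have v_commute: "v m m' = v m' m" if "m \<in> A" "m' \<in> A" for m m'
  proof -
    have "(4 * l m m') ^ 2 + (4 * m') ^ 2 = (4 * l m' m) ^ 2 + (4 * m) ^ 2"
      using l that by (simp add: power2_eq_square algebra_simps)
    then show ?thesis
      using le that unfolding v_def by (simp add: power_mult_distrib)
  qed
  have in_reps: "n - m ^ 2 \<in> reps W (v m m')" if "m \<in> A" "m' \<in> A" for m m'
  proof -
    have "l m m' \<ge> 1"
      using l[OF that] A[OF that(1)] by simp
    then show ?thesis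
      using in_W[OF that(1)] by (auto simp: reps_def v_def)
  qed
  have inj: "m = m'" if "n - m ^ 2 = n - m' ^ 2" "m \<in> A" "m' \<in> A" for m m'
  proof -
    have "m ^ 2 = m' ^ 2"
      using that le by (metis diff_diff_cancel)
    then show ?thesis by simp
  qed
  have "2 \<le> card (reps W (v m m'))" if "(m, m') \<in> P" for m m'
  proof -
    have "{n - m ^ 2, n - m' ^ 2} \<subseteq> reps W (v m m')"
      using in_reps[of m m'] in_reps[of m' m] v_commute[of m m'] that by (auto simp: P_def)
    moreover have "n - m ^ 2 \<noteq> n - m' ^ 2"
      using inj[of m m'] that by (auto simp: P_def)
    ultimately show ?thesis
      using card_mono[of "reps W (v m m')" "{n - m ^ 2, n - m' ^ 2}"] by simp
  qed
  moreover have "v m m' \<in> {1..N}" if "(m, m') \<in> P" for m m'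
  proof -
    have m: "m \<in> A" "m' \<in> A" using that by (auto simp: P_def)
    have "l m m' \<ge> 1"
      using l[OF m] A[OF m(1)] by simp
    then have "1 \<le> v m m'"
      by (simp add: v_def Suc_le_eq)
    have "l m m' \<le> 2 * max m m'"
      using l[OF m] by auto
    then have "l m m' ^ 2 \<le> (2 * max m m') ^ 2"
      by (rule power_mono) simp
    also have "\<dots> \<le> 4 * n"
      using le m by (auto simp: power_mult_distrib max_def)
    finally have "v m m' \<le> 5 * n"
      by (simp add: v_def)
    with \<open>1 \<le> v m m'\<close> show ?thesis
      using \<open>5 * n \<le> N\<close> by simp
  qed
  ultimately have "(\<Sum>n\<in>S. card (reps W n)) \<le> 2 * excess W N"
    by (intro sum_card_reps_le_excess) (auto simp: S_def)
  moreover have "finite P"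
    using \<open>finite A\<close> by (simp add: P_def)
  then have "finite S"
    by (simp add: S_def)
  moreover have "card P \<le> card (Sigma S (reps W))"
  proof (rule card_inj_on_le)
    \<comment> \<open>The second component recovers \<open>m\<close>; then the first recovers
      \<open>l m m'\<close> and hence \<open>m'\<close>.\<close>
    show "inj_on (\<lambda>(m, m'). (v m m', n - m ^ 2)) P"
    proof (rule inj_onI, clarify)
      fix m1 m1' m2 m2'
      assume *: "(m1, m1') \<in> P" "(m2, m2') \<in> P" "v m1 m1' = v m2 m2'" "n - m1\<^sup>2 = n - m2\<^sup>2"
      then have mA: "m1 \<in> A" "m1' \<in> A" "m2 \<in> A" "m2' \<in> A" by (auto simp: P_def)
      have "m1 = m2" using inj[OF *(4) mA(1,3)] .
      moreover have "l m1 m1' = l m2 m2'"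
        using *(3,4) by (simp add: v_def)
      ultimately show "m1 = m2 \<and> m1' = m2'"
        using l[OF mA(1,2)] l[OF mA(3,4)] by linarith
    qed
    show "(\<lambda>(m, m'). (v m m', n - m\<^sup>2)) ` P \<subseteq> Sigma S (reps W)"
      using in_reps by (force simp: S_def P_def)
    show "finite (Sigma S (reps W))"
      using \<open>finite S\<close> by simp
  qed
  moreover have "card P = card A * (card A - 1)"
    using \<open>finite A\<close> by (simp add: P_def)
  ultimately show ?thesis by simp
qed

text \<open>Pigeonhole: \<open>c\<close> is the size of a residue class modulo 4 holding at least a
  quarter of the roots.\<close>

lemma card_reps_le_excess:
  assumes "5 * n \<le> N"
  obtains c where "card (reps W n) \<le> 4 * c" "c * (c - 1) \<le> 2 * excess W N"
proof -
  define A where "A r = {m. m \<ge> 1 \<and> m mod 4 = r \<and> (\<exists>w\<in>W. w + m ^ 2 = n)}" for r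
  have "m \<le> n" if "w + m ^ 2 = n" for w m :: nat
    using that self_le_power[of m 2] by (cases "m = 0") auto
  then have "A r \<subseteq> {..n}" for r
    by (auto simp: A_def)
  then have finite: "finite (A r)" for r
    using finite_subset finite_atMost by blast
  have "reps W n \<subseteq> (\<Union>r<4. (\<lambda>m. n - m ^ 2) ` A r)"
    by (force simp: reps_def A_def)
  then have "card (reps W n) \<le> card (\<Union>r<4. (\<lambda>m. n - m ^ 2) ` A r)"
    using finite by (intro card_mono) auto
  also have "\<dots> \<le> (\<Sum>r<4. card ((\<lambda>m. n - m ^ 2) ` A r))"
    by (rule card_UN_le) simp
  also have "\<dots> \<le> (\<Sum>r<4. card (A r))"
    by (intro sum_mono card_image_le finite)
  finally have le: "card (reps W n) \<le> (\<Sum>r<4. card (A r))" .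
  have "\<exists>r<4. card (reps W n) \<le> 4 * card (A r)"
  proof (rule ccontr)
    assume "\<not> ?thesis"
    then have "(\<Sum>r<4. 4 * card (A r)) < (\<Sum>r<4::nat. card (reps W n))"
      by (intro sum_strict_mono) (auto simp: not_le lessThan_empty_iff)
    with le show False
      by (simp flip: sum_distrib_left)
  qed
  then obtain r where "card (reps W n) \<le> 4 * card (A r)" by blast
  moreover have "card (A r) * (card (A r) - 1) \<le> 2 * excess W N"
    by (rule residue_class_le_excess[OF assms finite, of r r]) (auto simp: A_def)
  ultimately show thesis by (rule that)
qed

section \<open>Coincidences from a common residue class\<close>

text \<open>In each residue class, the least such element allows only one larger one, at distance
  \<open>d\<close>.\<close>

lemma card_without_partner_le:
  fixes V :: "nat set"
  assumes "finite V" "M > 0"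
  shows "card {w \<in> V. \<forall>w'\<in>V. w < w' \<and> w' mod M = w mod M \<longrightarrow> w' = w + d} \<le> 2 * M"
    (is "card ?B \<le> _")
proof -
  define B where "B r = {w \<in> ?B. w mod M = r}" for r
  have "card (B r) \<le> 2" for r
  proof (cases "B r = {}")
    case False
    have fin: "finite (B r)"
      using \<open>finite V\<close> by (simp add: B_def)
    define \<mu> where "\<mu> = Min (B r)"
    have "\<mu> \<in> B r"
      unfolding \<mu>_def using fin False by (rule Min_in)
    have "B r \<subseteq> {\<mu>, \<mu> + d}"
    proof
      fix x assume "x \<in> B r"
      then have "\<mu> \<le> x"
        unfolding \<mu>_def using fin by simp
      then show "x \<in> {\<mu>, \<mu> + d}"
        using \<open>x \<in> B r\<close> \<open>\<mu> \<in> B r\<close> by (cases "\<mu> = x") (auto simp: B_def)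
    qed
    then have "card (B r) \<le> card {\<mu>, \<mu> + d}"
      by (intro card_mono) auto
    also have "\<dots> \<le> 2"
      by (simp add: card_insert_if)
    finally show ?thesis .
  qed simp
  then have "(\<Sum>r<M. card (B r)) \<le> (\<Sum>r<M. 2)"
    by (intro sum_mono)
  moreover have "?B = (\<Union>r<M. B r)"
    using \<open>M > 0\<close> by (auto simp: B_def)
  then have "card ?B = card (\<Union>r<M. B r)"
    by (rule arg_cong)
  moreover have "card (\<Union>r<M. B r) \<le> (\<Sum>r<M. card (B r))"
    by (rule card_UN_le) simp
  moreover have "(\<Sum>r<M. 2) = 2 * M"
    by simp
  ultimately show ?thesis by linarith
qed

text \<open>For \<open>q\<close> between \<open>Q\<close> and \<open>2 Q\<close>, a coincidence \<open>w + (q + j)\<^sup>2 = w' + (q - j)\<^sup>2\<close> with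
  \<open>j \<noteq> q\<close> determines the pair \<open>{q, j}\<close>, and the truth value of \<open>j < q\<close> tells which of the two is
  \<open>q\<close>; this costs the factor 2. Since \<open>4 q j \<le> 4096 Q\<^sup>2\<close>, we have \<open>q + j \<le> 1026 Q\<close>.\<close>

lemma sum_card_reps_squared_ge:
  assumes "Q \<ge> 1"
  shows "Q * (card (W \<inter> {..4096 * Q ^ 2}) - 16 * Q) \<le>
           2 * (\<Sum>n | n \<in> {1..4000000 * Q ^ 2} \<and> card (reps W n) \<ge> 2. card (reps W n) ^ 2)"
proof -
  define V where "V = W \<inter> {..4096 * Q ^ 2}"
  define S where "S = {n. n \<in> {1..4000000 * Q ^ 2} \<and> card (reps W n) \<ge> 2}"
  \<comment> \<open>The excluded difference is the case j = q, where the second square would be 0,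
    which is not in \<open>squares\<close>.\<close>
  define partner where
    "partner q w w' \<longleftrightarrow> w' \<in> V \<and> w < w' \<and> w' mod (4 * q) = w mod (4 * q) \<and> w' \<noteq> w + 4 * q ^ 2"
    for q w w'
  define G where "G q = {w \<in> V. \<exists>w'. partner q w w'}" for q
  define p where "p q w = (SOME w'. partner q w w')" for q w
  define j where "j q w = (p q w - w) div (4 * q)" for q w
  define P where "P = Sigma {Q<..2 * Q} G"
  have "finite V" by (simp add: V_def)
  \<comment> \<open>At most two elements are lost in each of the 4 q \<le> 8 Q classes.\<close>
  have card_G: "card V - 16 * Q \<le> card (G q)" if "q \<in> {Q<..2 * Q}" for q
  proof -
    have "V - G q = {w \<in> V. \<forall>w'\<in>V. w < w' \<and> w' mod (4 * q) = w mod (4 * q) \<longrightarrow> w' = w + 4 * q ^ 2}"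
      by (auto simp: G_def partner_def)
    then have "card (V - G q) \<le> 2 * (4 * q)"
      using card_without_partner_le[OF \<open>finite V\<close>, of "4 * q" "4 * q ^ 2"] that by simp
    moreover have "card (V - G q) = card V - card (G q)"
      using \<open>finite V\<close> by (intro card_Diff_subset) (auto simp: G_def)
    ultimately show ?thesis using that by auto
  qed
  have p: "w \<in> V \<and> partner q w (p q w) \<and> q > Q \<and> q \<le> 2 * Q" if "(q, w) \<in> P" for q w
  proof -
    have "\<exists>w'. partner q w w'" using that by (simp add: P_def G_def)
    then have "partner q w (p q w)" unfolding p_def by (rule someI_ex)
    then show ?thesis using that by (simp add: P_def G_def)
  qed
  have j: "p q w = w + 4 * q * j q w" if "(q, w) \<in> P" for q w
  proof -
    have "4 * q dvd p q w - w"
      using p[OF that] mod_eq_dvd_iff_nat[of w "p q w" "4 * q"] by (simp add: partner_def)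
    then have "4 * q * j q w = p q w - w"
      unfolding j_def by simp
    then show ?thesis using p[OF that] by (simp add: partner_def)
  qed
  have reps: "w \<in> reps W (w + (q + j q w) ^ 2) \<and> p q w \<in> reps W (w + (q + j q w) ^ 2) \<and>
      w + (q + j q w) ^ 2 \<in> S" if "(q, w) \<in> P" for q w
  proof -
    define i where "i = j q w"
    have w: "w \<in> W" "w \<le> 4096 * Q ^ 2" "p q w \<in> W" "p q w \<le> 4096 * Q ^ 2" "w < p q w"
        "Q < q" "q \<le> 2 * Q" "p q w \<noteq> w + 4 * q ^ 2"
      using p[OF that] by (auto simp: partner_def V_def)
    have pi: "p q w = w + 4 * q * i"
      using j[OF that] by (simp add: i_def)
    have "i \<noteq> q"
      using w(8) pi by (auto simp: power2_eq_square)
    have 1: "w \<in> reps W (w + (q + i) ^ 2)"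
      using w by (auto simp: reps_def intro!: exI[of _ "q + i"])
    have "\<exists>d\<ge>1. p q w + d ^ 2 = w + (q + i) ^ 2"
    proof (cases "i < q")
      case True
      then obtain d where "q = i + d" "d \<ge> 1"
        using less_imp_add_positive[of i q] by auto
      then show ?thesis
        unfolding pi by (intro exI[of _ d]) (auto simp: power2_eq_square algebra_simps)
    next
      case False
      then obtain d where "i = q + d" "d \<ge> 1"
        using \<open>i \<noteq> q\<close> less_imp_add_positive[of q i] by auto
      then show ?thesis
        unfolding pi by (intro exI[of _ d]) (auto simp: power2_eq_square algebra_simps)
    qed
    then have 2: "p q w \<in> reps W (w + (q + i) ^ 2)"
      using w by (auto simp: reps_def)
    have "4 * Q * i \<le> 4 * q * i"
      using w by simp
    also have "\<dots> \<le> 4096 * Q ^ 2"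
      using pi w by linarith
    finally have "Q * i \<le> Q * (1024 * Q)"
      by (simp add: power2_eq_square)
    then have "q + i \<le> 1026 * Q"
      using \<open>Q \<ge> 1\<close> w by simp
    then have "(q + i) ^ 2 \<le> (1026 * Q) ^ 2"
      by (rule power_mono) simp
    then have "w + (q + i) ^ 2 \<le> 4000000 * Q ^ 2"
      using w by (simp add: power_mult_distrib)
    moreover have "w + (q + i) ^ 2 \<ge> 1"
      using w by (simp add: Suc_le_eq)
    moreover have "card (reps W (w + (q + i) ^ 2)) \<ge> 2"
      using card_mono[of "reps W (w + (q + i) ^ 2)" "{w, p q w}"] 1 2 w by simp
    ultimately show ?thesis
      using 1 2 by (simp add: S_def flip: i_def)
  qed
  have "finite S"
    by (simp add: S_def)
  define \<phi> where "\<phi> = (\<lambda>(q, w). (w + (q + j q w) ^ 2, (w, p q w), j q w < q))"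
  have "inj_on \<phi> P"
  proof (rule inj_onI, clarify)
    fix q1 w1 q2 w2
    assume P: "(q1, w1) \<in> P" "(q2, w2) \<in> P" and eq: "\<phi> (q1, w1) = \<phi> (q2, w2)"
    define i1 i2 where "i1 = j q1 w1" and "i2 = j q2 w2"
    have w: "w1 = w2" and sum: "(q1 + i1) ^ 2 = (q2 + i2) ^ 2" and "p q1 w1 = p q2 w2"
      and less: "i1 < q1 \<longleftrightarrow> i2 < q2"
      using eq by (auto simp: \<phi>_def i1_def i2_def)
    then have prod: "q1 * i1 = q2 * i2"
      using j[OF P(1)] j[OF P(2)] by (simp add: i1_def i2_def)
    have sum': "q1 + i1 = q2 + i2"
      using sum by simp
    \<comment> \<open>Equal sums and products make \<open>q1\<close> a root of the quadratic with
      roots \<open>q2\<close> and \<open>i2\<close>.\<close>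
    have "(int q1 - int q2) * (int q1 - int i2) =
        int q1 * (int q1 - (int q2 + int i2)) + int q2 * int i2"
      by (simp add: algebra_simps)
    also have "int q2 + int i2 = int q1 + int i1"
      using sum' by linarith
    also have "int q2 * int i2 = int q1 * int i1"
      using prod by (metis of_nat_mult)
    also have "int q1 * (int q1 - (int q1 + int i1)) + int q1 * int i1 = 0"
      by (simp add: algebra_simps)
    finally have "q1 = q2 \<or> q1 = i2"
      by simp
    \<comment> \<open>If \<open>q1 = i2\<close>, then \<open>i1 = q2\<close>, and the flag says that
      \<open>q2 < q1\<close> iff \<open>q1 < q2\<close>.\<close>
    then have "q1 = q2"
      using sum' less by linarith
    with w show "q1 = q2 \<and> w1 = w2" by simp
  qed
  moreover have "\<phi> ` P \<subseteq> Sigma S (\<lambda>n. (reps W n \<times> reps W n) \<times> UNIV)"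
    using reps by (auto simp: \<phi>_def)
  moreover have "finite (Sigma S (\<lambda>n. (reps W n \<times> reps W n) \<times> (UNIV :: bool set)))"
    using \<open>finite S\<close> by simp
  ultimately have "card P \<le> card (Sigma S (\<lambda>n. (reps W n \<times> reps W n) \<times> (UNIV :: bool set)))"
    by (rule card_inj_on_le)
  also have "\<dots> = 2 * (\<Sum>n\<in>S. card (reps W n) ^ 2)"
    using \<open>finite S\<close> by (simp add: card_cartesian_product power2_eq_square sum_distrib_left mult_ac)
  finally have "card P \<le> 2 * (\<Sum>n\<in>S. card (reps W n) ^ 2)" .
  moreover have "Q * (card V - 16 * Q) = (\<Sum>q\<in>{Q<..2 * Q}. card V - 16 * Q)"
    by simp
  moreover have "\<dots> \<le> (\<Sum>q\<in>{Q<..2 * Q}. card (G q))"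
    by (intro sum_mono card_G)
  moreover have "\<dots> = card P"
    using \<open>finite V\<close> by (simp add: P_def G_def)
  ultimately show ?thesis
    unfolding S_def V_def by linarith
qed

section \<open>Size of the complement\<close>

text \<open>Elements up to \<open>R ^ 2\<close> together with roots up to \<open>R\<close> must
  produce every integer from \<open>n0\<close> to \<open>R ^ 2\<close>.\<close>

lemma card_complement_ge:
  assumes "\<And>n. n \<ge> n0 \<Longrightarrow> reps W n \<noteq> {}"
  shows "R ^ 2 \<le> n0 + card (W \<inter> {..R ^ 2}) * R"
proof -
  have "{n0..R ^ 2} \<subseteq> (\<lambda>(w, m). w + m ^ 2) ` ((W \<inter> {..R ^ 2}) \<times> {1..R})"
  proof
    fix n assume n: "n \<in> {n0..R ^ 2}"
    then obtain w m where wm: "w \<in> W" "m \<ge> 1" "w + m ^ 2 = n"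
      using assms[of n] by (auto simp: reps_def)
    moreover have "m ^ 2 \<le> R ^ 2" "w \<le> R ^ 2"
      using wm n unfolding atLeastAtMost_iff by linarith+
    moreover have "m \<le> R"
      using \<open>m ^ 2 \<le> R ^ 2\<close> by (rule power2_le_imp_le) simp
    ultimately show "n \<in> (\<lambda>(w, m). w + m ^ 2) ` ((W \<inter> {..R ^ 2}) \<times> {1..R})"
      by force
  qed
  then have "card {n0..R ^ 2} \<le> card ((W \<inter> {..R ^ 2}) \<times> {1..R})"
    by (intro surj_card_le) auto
  then show ?thesis by (simp add: card_cartesian_product)
qed

text \<open>Each pair of such an element and a root up to \<open>M\<close> represents some number up
  to \<open>N\<close>, and there are at most \<open>N + excess W N\<close> such
  representations.\<close>

lemma card_complement_le:
  assumes "L + M ^ 2 \<le> N"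
  shows "card (W \<inter> {..L}) * M \<le> N + excess W N"
proof -
  have "card ((W \<inter> {..L}) \<times> {1..M}) \<le> card (Sigma {1..N} (reps W))"
  proof (rule card_inj_on_le)
    show "inj_on (\<lambda>(w, m). (w + m ^ 2, w)) ((W \<inter> {..L}) \<times> {1..M})"
      by (auto simp: inj_on_def)
    show "(\<lambda>(w, m). (w + m ^ 2, w)) ` ((W \<inter> {..L}) \<times> {1..M}) \<subseteq> Sigma {1..N} (reps W)"
    proof clarify
      fix w m assume *: "w \<in> W" "w \<le> L" "m \<in> {1..M}"
      then have "m ^ 2 \<le> M ^ 2" by (intro power_mono) auto
      then have "w + m ^ 2 \<le> N"
        using * assms by linarith
      with * show "w + m ^ 2 \<in> {1..N} \<and> w \<in> reps W (w + m ^ 2)"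
        by (auto simp: reps_def Suc_le_eq)
    qed
  qed simp
  then have "card (W \<inter> {..L}) * M \<le> (\<Sum>n = 1..N. card (reps W n))"
    by (simp add: card_cartesian_product)
  also have "\<dots> \<le> (\<Sum>n = 1..N. 1 + (card (reps W n) - 1))"
    by (intro sum_mono) simp
  also have "\<dots> = N + excess W N"
    by (simp add: excess_def sum.distrib del: One_nat_def)
  finally show ?thesis .
qed

section \<open>The lower bound for \<open>N = 20000000 * Q ^ 2\<close>\<close>

text \<open>The complement has at least \<open>32 Q\<close> elements up to \<open>(64 Q)\<^sup>2 = 4096 Q\<^sup>2\<close>, twice the loss
  \<open>16 Q\<close> in \<open>sum_card_reps_squared_ge\<close>. The range \<open>20000000 Q\<^sup>2\<close> is five times the range
  \<open>4000000 Q\<^sup>2\<close> of that lemma, as \<open>card_reps_le_excess\<close> requires.\<close>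

lemma excess_ge:
  fixes Q n0 :: nat
  assumes n0: "\<And>n. n \<ge> n0 \<Longrightarrow> reps W n \<noteq> {}" and "n0 \<le> Q" "Q \<ge> 5004"
  shows "real Q * sqrt Q / (10 ^ 9 * sqrt (max_num_divisors (20000000 * Q ^ 2)))
           \<le> excess W (20000000 * Q ^ 2)"
proof -
  define N where "N = 20000000 * Q ^ 2"
  define E where "E = real (excess W N)"
  define T where "T = real (max_num_divisors N)"
  define q where "q = real Q"
  define U where "U = W \<inter> {..4000000 * Q ^ 2}"
  define S where "S = {n. n \<in> {1..4000000 * Q ^ 2} \<and> card (reps W n) \<ge> 2}"
  define Z where "Z = (\<Sum>n\<in>S. real (card (reps W n)) ^ 2)"
  have q: "q \<ge> 5004" using assms by (simp add: q_def)
  have "N \<ge> 1" using assms by (simp add: N_def)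
  then have T: "T \<ge> 1" using max_num_divisors_ge_1 by (simp add: T_def)
  have "E \<ge> 0" by (simp add: E_def)
  \<comment> \<open>Two of the three cases below give an excess of order q^2, which is more than
    enough.\<close>
  have quadratic: "q * sqrt q / (10 ^ 9 * sqrt T) \<le> E" if "q ^ 2 / 10 ^ 9 \<le> E"
  proof -
    have "sqrt q \<le> sqrt (q ^ 2)"
      using q by (intro real_sqrt_le_mono) (simp add: power2_eq_square)
    then have "sqrt q \<le> q" using q by simp
    then have "q * sqrt q / (10 ^ 9 * sqrt T) \<le> (q * q) / (10 ^ 9 * 1)"
      using q T by (intro frac_le mult_mono) auto
    also have "\<dots> \<le> E" using that by (simp add: power2_eq_square)
    finally show ?thesis .
  qed
  have "q * sqrt q / (10 ^ 9 * sqrt T) \<le> E"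
  proof (cases "E \<ge> q ^ 2")
    case True
    moreover have "q ^ 2 / 10 ^ 9 \<le> q ^ 2" by simp
    ultimately show ?thesis by (intro quadratic) linarith
  next
    case False
    \<comment> \<open>The root range \<open>4000 * Q\<close> contributes 16000000 Q^2, exactly
      filling up \<open>N\<close>.\<close>
    have "4000000 * Q ^ 2 + (4000 * Q) ^ 2 \<le> N"
      by (simp add: N_def power_mult_distrib)
    then have "card U * (4000 * Q) \<le> N + excess W N"
      unfolding U_def by (rule card_complement_le)
    then have "real (card U * (4000 * Q)) \<le> real (N + excess W N)"
      by (rule of_nat_mono)
    then have "4000 * q * card U \<le> 20000000 * q ^ 2 + E"
      by (simp add: N_def E_def q_def mult_ac)
    also have "\<dots> \<le> 4000 * q * (5001 * q)"
    proof -
      have "E \<le> 4000 * q ^ 2"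
        using False zero_le_power2[of q] by linarith
      then show ?thesis by (simp add: power2_eq_square)
    qed
    finally have card_U: "card U \<le> 5001 * q"
      using q by simp

    define k where "k = card (W \<inter> {..4096 * Q ^ 2})"
    have "(64 * Q) ^ 2 \<le> n0 + card (W \<inter> {..(64 * Q) ^ 2}) * (64 * Q)"
      by (rule card_complement_ge[OF n0])
    then have "4096 * Q ^ 2 \<le> Q + k * (64 * Q)"
      using \<open>n0 \<le> Q\<close> by (simp add: k_def power_mult_distrib)
    then have "Q * (4096 * Q) \<le> Q * (1 + 64 * k)"
      by (simp add: power2_eq_square algebra_simps)
    then have "4096 * Q \<le> 1 + 64 * k"
      by (rule mult_left_le_imp_le) (use assms in simp)
    then have "16 * Q \<le> k - 16 * Q"
      using assms by linarith
    then have "Q * (16 * Q) \<le> Q * (k - 16 * Q)"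
      by (rule mult_le_mono2)
    also have "\<dots> \<le> 2 * (\<Sum>n\<in>S. card (reps W n) ^ 2)"
      unfolding k_def S_def using assms by (intro sum_card_reps_squared_ge) simp
    finally have "real (Q * (16 * Q)) \<le> real (2 * (\<Sum>n\<in>S. card (reps W n) ^ 2))"
      by (rule of_nat_mono)
    then have Z: "8 * q ^ 2 \<le> Z"
      by (simp add: Z_def q_def power2_eq_square)

    show ?thesis
    \<comment> \<open>The threshold plays the part of \<open>F\<close>. As 10002 = 2 * 5001, the
      diagonal term is then at most half of \<open>Z ^ 2\<close> and can be absorbed.\<close>
    proof (cases "\<exists>n\<in>S. real (card (reps W n)) > Z / (10002 * q)")
      case True
      then obtain n where n: "n \<in> S" "real (card (reps W n)) > Z / (10002 * q)" by blast
      then have "5 * n \<le> N" by (simp add: S_def N_def)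
      then obtain c where c: "card (reps W n) \<le> 4 * c" "c * (c - 1) \<le> 2 * excess W N"
        by (rule card_reps_le_excess)
      have "8 * q ^ 2 / (10002 * q) \<le> Z / (10002 * q)"
        using Z q by (intro divide_right_mono) auto
      then have "8 * q ^ 2 / (10002 * q) < real (4 * c)"
        using n c by linarith
      then have c_gt: "q / 5004 < real c"
        using q by (simp add: power2_eq_square field_simps)
      \<comment> \<open>Here \<open>Q \<ge> 5004\<close> forces the integer \<open>c\<close> above
        1.\<close>
      then have "c \<ge> 2"
        using q by simp
      then have "real c * (real c - 1) = real (c * (c - 1))"
        by (simp add: of_nat_diff)
      also have "\<dots> \<le> 2 * E"
        unfolding E_def using of_nat_mono[OF c(2), where 'a = real] by simp
      finally have "real c * (real c - 1) \<le> 2 * E" .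
      moreover have "real c * (real c / 2) \<le> real c * (real c - 1)"
        using \<open>c \<ge> 2\<close> by (intro mult_left_mono) auto
      moreover have "(q / 5004) ^ 2 \<le> real c ^ 2"
        using c_gt q by (intro power_mono) auto
      ultimately have "q ^ 2 / (4 * 5004 ^ 2) \<le> E"
        by (simp add: power2_eq_square)
      moreover have "q ^ 2 / 10 ^ 9 \<le> q ^ 2 / (4 * 5004 ^ 2)"
        by (intro divide_left_mono) auto
      ultimately show ?thesis by (intro quadratic) linarith
    next
      case False
      define s where "s = (\<Sum>n\<in>S. real (card (reps W n)))"
      have "(\<Sum>n\<in>S. card (reps W n)) \<le> 2 * excess W N"
        by (rule sum_card_reps_le_excess) (auto simp: S_def N_def)
      then have s: "s \<le> 2 * E" "0 \<le> s"
        unfolding s_def E_def by (auto simp flip: of_nat_sum intro: sum_nonneg)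
      have inter: "real (card (reps W n \<inter> reps W n')) \<le> T" if "n \<in> S" "n' \<in> S" "n < n'" for n n'
      proof -
        have "num_divisors (n' - n) \<le> max_num_divisors N"
          using that by (intro num_divisors_le_max) (auto simp: S_def N_def)
        then show ?thesis
          using card_common_reps_le[OF \<open>n < n'\<close>, of W] by (simp add: T_def)
      qed
      have "0 \<le> Z"
        unfolding Z_def by (intro sum_nonneg) simp
      have "Z ^ 2 \<le> card U * (Z / (10002 * q) * Z + T * s ^ 2)"
        unfolding Z_def s_def
      proof (rule sum_card_squared_le)
        show "reps W n \<subseteq> U" if "n \<in> S" for n
          using that by (auto simp: reps_def U_def S_def)
        show "real (card (reps W n)) \<le> (\<Sum>n\<in>S. (real (card (reps W n)))\<^sup>2) / (10002 * q)"
          if "n \<in> S" for n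
          using False that by (auto simp: Z_def not_less)
        show "real (card (reps W n \<inter> reps W n')) \<le> T" if "n \<in> S" "n' \<in> S" "n \<noteq> n'" for n n'
          using inter[of n n'] inter[of n' n] that by (cases "n < n'") (auto simp: Int_commute)
      qed (use T in \<open>auto simp: S_def U_def\<close>)
      also have "\<dots> \<le> (5001 * q) * (Z / (10002 * q) * Z + T * (2 * E) ^ 2)"
        using card_U s T q \<open>0 \<le> Z\<close> by (intro mult_mono add_mono mult_left_mono power_mono) auto
      also have "\<dots> = Z ^ 2 / 2 + 20004 * q * T * E ^ 2"
        using q by (simp add: field_simps power2_eq_square)
      finally have "Z ^ 2 \<le> 40008 * q * T * E ^ 2" by simp
      moreover have "(8 * q ^ 2) ^ 2 \<le> Z ^ 2"
        using Z by (intro power_mono) auto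
      ultimately have "q * (64 * q ^ 3) \<le> q * (40008 * T * E ^ 2)"
        by (simp add: power2_eq_square power3_eq_cube algebra_simps)
      then have "64 * q ^ 3 \<le> 40008 * (T * E ^ 2)"
        using q by simp
      moreover have "0 \<le> T * E ^ 2" using T by simp
      ultimately have "q ^ 3 \<le> (10 ^ 9) ^ 2 * (T * E ^ 2)" by simp
      moreover have "(q * sqrt q) ^ 2 = q ^ 2 * q"
        using q by (simp add: power_mult_distrib)
      moreover have "q ^ 2 * q = q ^ 3"
        by (simp add: power2_eq_square power3_eq_cube)
      moreover have "(10 ^ 9 * sqrt T * E) ^ 2 = (10 ^ 9) ^ 2 * (T * E ^ 2)"
        using T by (simp add: power_mult_distrib)
      ultimately have "(q * sqrt q) ^ 2 \<le> (10 ^ 9 * sqrt T * E) ^ 2"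
        by presburger
      then have "q * sqrt q \<le> 10 ^ 9 * sqrt T * E"
        by (rule power2_le_imp_le) (use T \<open>E \<ge> 0\<close> in simp)
      then show ?thesis
        using T by (simp add: divide_le_eq mult_ac)
    qed
  qed
  then show ?thesis by (simp add: q_def T_def E_def N_def)
qed

section \<open>Passage to arbitrary \<open>N\<close>\<close>

lemma powr_three_quarters:
  assumes "x \<ge> 0"
  shows "x powr (3 / 4) = sqrt x * sqrt (sqrt x)"
proof -
  have "sqrt x * sqrt (sqrt x) = x powr (1 / 2) * (x powr (1 / 2)) powr (1 / 2)"
    using assms by (simp add: powr_half_sqrt)
  also have "\<dots> = x powr (3 / 4)"
    by (simp add: powr_powr flip: powr_add)
  finally show ?thesis by simp
qed

theorem theorem2:
  fixes W :: "nat set"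
  assumes "additive_complement_of_squares W"
  shows "\<exists>C::real. C > 0 \<and>
           (\<forall>\<^sub>F N :: nat in sequentially.
              real (\<Sum>n = 1..N. rep_count W n) - real N
                \<ge> C * (real N powr (3 / 4) / sqrt (real (max_num_divisors N))))"
proof -
  obtain n0 where "\<And>n. n \<ge> n0 \<Longrightarrow> \<exists>w\<in>W. \<exists>s\<in>squares. n = w + s"
    using assms by (auto simp: additive_complement_of_squares_def)
  then have n0: "reps W n \<noteq> {}" if "n \<ge> n0" for n
    using that by (fastforce simp: reps_def squares_def)
  \<comment> \<open>One more than \<open>n0 + 5004\<close>, to make up for rounding down in
    \<open>Q\<close>.\<close>
  define K where "K = n0 + 5005"
  have bound: "1 / (2 * 10 ^ 15) * (real N powr (3 / 4) / sqrt (real (max_num_divisors N)))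
      \<le> real (\<Sum>n = 1..N. rep_count W n) - real N"
    if N: "N \<ge> 20000000 * K ^ 2" "N \<ge> (2 * 10 ^ 15 * n0) ^ 4" for N
  proof -
    define X where "X = real N powr (3 / 4) / sqrt (real (max_num_divisors N))"
    define Q where "Q = nat \<lfloor>sqrt (N / 20000000)\<rfloor>"
    have "N \<ge> 1"
      using N(1) by (auto simp: K_def intro: order_trans[rotated])
    have "real (20000000 * K ^ 2) \<le> real N"
      using N(1) by (rule of_nat_mono)
    then have "real K \<le> sqrt (N / 20000000)"
      by (intro real_le_rsqrt) simp
    moreover have Q: "real Q \<le> sqrt (N / 20000000)" "sqrt (N / 20000000) < real Q + 1"
      unfolding Q_def by (simp_all add: of_nat_nat)
    ultimately have "n0 \<le> Q" "5004 \<le> Q"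
      by (auto simp: K_def)
    have "real Q ^ 2 \<le> sqrt (N / 20000000) ^ 2"
      using Q by (intro power_mono) auto
    then have "real (20000000 * Q ^ 2) \<le> real N"
      by simp
    then have Q_le: "20000000 * Q ^ 2 \<le> N"
      by (simp only: of_nat_le_iff)
    have "sqrt (N / 20000000) \<le> 2 * real Q"
      using Q \<open>5004 \<le> Q\<close> by linarith
    then have "sqrt (N / 20000000) ^ 2 \<le> (2 * real Q) ^ 2"
      by (intro power_mono) auto
    \<comment> \<open>20000000 * 4 is at most (10^4)^2.\<close>
    then have "real N \<le> (10 ^ 4 * real Q) ^ 2"
      by (simp add: power_mult_distrib)
    then have sqrt_N: "sqrt N \<le> 10 ^ 4 * real Q"
      by (intro real_le_lsqrt) auto
    then have "sqrt (sqrt N) \<le> sqrt (10 ^ 4 * real Q)"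
      by simp
    also have "\<dots> = sqrt ((10 ^ 2) ^ 2 * real Q)"
      by simp
    also have "\<dots> = 10 ^ 2 * sqrt Q"
      by (subst real_sqrt_mult) simp
    finally have "sqrt N * sqrt (sqrt N) \<le> (10 ^ 4 * real Q) * (10 ^ 2 * sqrt Q)"
      using sqrt_N by (intro mult_mono) auto
    then have powr: "real N powr (3 / 4) \<le> 10 ^ 6 * (Q * sqrt Q)"
      by (simp add: powr_three_quarters)
    have Q1: "1 \<le> 20000000 * Q ^ 2"
      using \<open>5004 \<le> Q\<close> by simp
    note T = max_num_divisors_ge_1[OF Q1] max_num_divisors_mono[OF Q1 Q_le]
    have "X \<le> 10 ^ 6 * (Q * sqrt Q) / sqrt (max_num_divisors (20000000 * Q ^ 2))"
      unfolding X_def using T powr by (intro frac_le) auto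
    also have "\<dots> = 10 ^ 15 * (Q * sqrt Q / (10 ^ 9 * sqrt (max_num_divisors (20000000 * Q ^ 2))))"
      by simp
    also have "\<dots> \<le> 10 ^ 15 * real (excess W (20000000 * Q ^ 2))"
      by (intro mult_left_mono excess_ge[of n0]) (use n0 \<open>n0 \<le> Q\<close> \<open>5004 \<le> Q\<close> in auto)
    also have "\<dots> \<le> 10 ^ 15 * real (excess W N)"
      using excess_mono[OF Q_le, of W] by simp
    finally have "X \<le> 10 ^ 15 * real (excess W N)" by simp
    \<comment> \<open>Half of the main term pays for the error \<open>n0\<close>; this is the factor
      2 in the final constant.\<close>
    moreover have "2 * 10 ^ 15 * real n0 \<le> X"
    proof -
      have "real ((2 * 10 ^ 15 * n0) ^ 4) \<le> real N"
        using N(2) by (rule of_nat_mono)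
      then have "((2 * 10 ^ 15 * real n0) ^ 2) ^ 2 \<le> real N"
        by simp
      then have "2 * 10 ^ 15 * real n0 \<le> sqrt (sqrt N)"
        by (intro real_le_rsqrt)
      also have "\<dots> = real N powr (3 / 4) / sqrt N"
        using \<open>N \<ge> 1\<close> by (simp add: powr_three_quarters)
      also have "\<dots> \<le> X"
        unfolding X_def
        using max_num_divisors_le[OF \<open>N \<ge> 1\<close>] max_num_divisors_ge_1[OF \<open>N \<ge> 1\<close>]
        by (intro frac_le) auto
      finally show ?thesis .
    qed
    moreover have "excess W N \<le> real (\<Sum>n = 1..N. rep_count W n) - real N + real n0"
      using n0 by (rule excess_le)
    ultimately show ?thesis
      unfolding X_def[symmetric] by simp
  qed
  have "\<forall>\<^sub>F N in sequentially.
      1 / (2 * 10 ^ 15) * (real N powr (3 / 4) / sqrt (real (max_num_divisors N)))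
        \<le> real (\<Sum>n = 1..N. rep_count W n) - real N"
    using eventually_ge_at_top[of "20000000 * K ^ 2"]
      eventually_ge_at_top[of "(2 * 10 ^ 15 * n0) ^ 4"]
    by eventually_elim (rule bound)
  then show ?thesis
    by (intro exI[of _ "1 / (2 * 10 ^ 15)"]) simp
qed

end
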